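(* Let $d\ge1$ be an integer and let $c>b>0$ be two integers. Let $b=\binom{b_d}{d}+\cdots+\binom{b_j}{j}$, $b_d>b_{d-1}>\cdots>b_j\geq j\geq1$, and $c=\binom{c_d}{d}+\cdots+\binom{c_i}{i}$, $c_d>c_{d-1}>\cdots>c_i\geq i\geq1$, be the $d$-binomial expansions of $b$ and $c$. The following statements are equivalent: (i) $b^{(d)}=c^{(d)}$. (ii) $j\geq2$ and $c-b\leq j-1$.
   Context: For a positive integer $a$ with $d$-binomial expansion $a=\binom{a_d}{d}+\binom{a_{d-1}}{d-1}+\cdots+\binom{a_j}{j}$, $a_d>a_{d-1}>\cdots>a_j\geq j\geq1$ (which exists and is unique), one sets $a^{(d)}=\binom{a_d}{d+1}+\binom{a_{d-1}}{d}+\cdots+\binom{a_j}{j+1}$. *)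

theory Defs imports Main begin

text \<open>
  The \<open>d\<close>-binomial expansion
  \<open>a = (k\<^sub>d choose d) + (k\<^sub>d\<^sub>-\<^sub>1 choose (d-1)) + \<dots> + (k\<^sub>j choose j)\<close> with
  \<open>k\<^sub>d > k\<^sub>d\<^sub>-\<^sub>1 > \<dots> > k\<^sub>j \<ge> j \<ge> 1\<close>.
  The top entries form a function \<open>k\<close> of which only the values on \<open>{j..d}\<close> matter.
\<close>

definition binomial_expansion :: "nat \<Rightarrow> nat \<Rightarrow> nat \<Rightarrow> (nat \<Rightarrow> nat) \<Rightarrow> bool" where
  "binomial_expansion d a j k \<longleftrightarrow>
     1 \<le> j \<and> j \<le> d \<and> j \<le> k j \<and> (\<forall>l\<in>{j..<d}. k l < k (Suc l)) \<and>
     a = (\<Sum>l = j..d. k l choose l)"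

text \<open>
  The number \<open>a\<^bsup>(d)\<^esup>\<close>, read off from the \<open>d\<close>-binomial expansion of \<open>a\<close>.  It is meaningful for
  \<open>a > 0\<close> and \<open>d \<ge> 1\<close>, where the expansion exists and is unique (for \<open>k\<close>: on \<open>{j..d}\<close>).
\<close>

definition binomial_shift :: "nat \<Rightarrow> nat \<Rightarrow> nat" where
  "binomial_shift d a =
     (THE m. \<exists>j k. binomial_expansion d a j k \<and> m = (\<Sum>l = j..d. k l choose (l + 1)))"

end

theory Submission imports Defs begin

text \<open>
  Setting \<open>k l = l - 1\<close> below the last index \<open>j\<close> of a \<open>d\<close>-binomial expansion adds only
  vanishing terms, both to \<open>a\<close> and to \<open>a\<^bsup>(d)\<^esup>\<close>.  So \<open>d\<close>-binomial expansions become
  sequences \<open>0 \<le> k 1 < \<dots> < k d\<close> (the combinatorial number system), all of the same length,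
  and \<open>j\<close> is recovered as the first index with \<open>k j \<ge> j\<close>.  The order of the numbers is the
  lexicographic order of these sequences, the top entry being the most significant: by Pascal's
  rule, the part of the sum up to index \<open>m\<close> stays below \<open>k m + 1 choose m\<close>
  (lemma \<open>cascade_sum_less\<close>).  This also makes the expansion unique, hence \<open>a\<^bsup>(d)\<^esup>\<close>
  computable from any expansion at hand (lemma \<open>binomial_shift_eq\<close>).

  Now let \<open>b < c\<close> and let \<open>m\<close> be the highest index at which their sequences \<open>\<beta>\<close> and \<open>\<gamma>\<close>
  differ, so \<open>\<beta> m < \<gamma> m\<close>.

  If \<open>j \<le> m\<close>, then a sharper form of the same Pascal estimate (lemma \<open>cascade_sum_gap\<close>)
  shows both \<open>b\<^bsup>(d)\<^esup> < c\<^bsup>(d)\<^esup>\<close> and \<open>c - b \<ge> j\<close>, so that (i) and (ii) both fail.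

  If \<open>m < j\<close>, then \<open>\<beta>\<close> contributes nothing up to \<open>m\<close>, and \<open>j = m + 1\<close>, because
  \<open>\<gamma> m \<ge> m\<close> leaves no room for a vanishing term at \<open>m + 1\<close>.  Both differences are then sums
  over \<open>\<gamma> 1, \<dots>, \<gamma> m\<close> alone.  If \<open>\<gamma> m = m\<close>, then every \<open>\<gamma> l \<le> l\<close>, so \<open>c - b \<le> m\<close>
  and the shifts agree; if \<open>\<gamma> m > m\<close>, then already the top term gives \<open>c - b \<ge> m + 1\<close> and
  \<open>c\<^bsup>(d)\<^esup> > b\<^bsup>(d)\<^esup>\<close>.
\<close>

section \<open>Strictly increasing top entries and their sums\<close>

definition cascade :: "nat \<Rightarrow> (nat \<Rightarrow> nat) \<Rightarrow> bool" where
  "cascade d k \<longleftrightarrow> (\<forall>l\<in>{1..<d}. k l < k (Suc l))"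

text \<open>For \<open>r = 0\<close> this is the number with top entries \<open>k\<close>, for \<open>r = 1\<close> its shift.\<close>

definition cascade_sum :: "nat \<Rightarrow> nat \<Rightarrow> (nat \<Rightarrow> nat) \<Rightarrow> nat" where
  "cascade_sum r m k = (\<Sum>l = 1..m. k l choose (l + r))"

definition pad :: "nat \<Rightarrow> (nat \<Rightarrow> nat) \<Rightarrow> nat \<Rightarrow> nat" where
  "pad j k l = (if l < j then l - 1 else k l)"

lemma cascade_sum_0 [simp]: "cascade_sum r 0 k = 0"
  by (simp add: cascade_sum_def)

lemma cascade_sum_Suc [simp]:
  "cascade_sum r (Suc m) k = cascade_sum r m k + (k (Suc m) choose (Suc m + r))"
  by (simp add: cascade_sum_def)

lemma cascade_restrict: "cascade d k \<Longrightarrow> m \<le> d \<Longrightarrow> cascade m k"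
  by (auto simp: cascade_def)

lemma cascade_Suc: "cascade (Suc m) k \<Longrightarrow> 1 \<le> m \<Longrightarrow> k m < k (Suc m)"
  by (simp add: cascade_def)

lemma cascade_slope:
  assumes "cascade m k" "1 \<le> l" "l \<le> m"
  shows "k l + (m - l) \<le> k m"
  using assms(3,1)
proof (induction m rule: dec_induct)
  case (step n)
  then have "k n < k (Suc n)" "k l + (n - l) \<le> k n"
    using assms(2) cascade_Suc cascade_restrict[of "Suc n" k n] by auto
  then show ?case using step.hyps by linarith
qed simp

lemma top_term_le_cascade_sum: "1 \<le> m \<Longrightarrow> k m choose (m + r) \<le> cascade_sum r m k"
  by (cases m) simp_all

lemma cascade_sum_eq_0:
  assumes "\<And>l. 1 \<le> l \<Longrightarrow> l \<le> m \<Longrightarrow> k l < l + r"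
  shows "cascade_sum r m k = 0"
  using assms by (simp add: cascade_sum_def)

lemma cascade_sum_below_diagonal:
  assumes "cascade m k" "k m < m + r"
  shows "cascade_sum r m k = 0"
proof (rule cascade_sum_eq_0)
  fix l assume "1 \<le> l" "l \<le> m"
  then show "k l < l + r"
    using cascade_slope[OF assms(1)] assms(2) by fastforce
qed

lemma cascade_sum_split:
  assumes "m \<le> d"
  shows "cascade_sum r d k = cascade_sum r m k + (\<Sum>l\<in>{m<..d}. k l choose (l + r))"
proof -
  have "{1..d} = {1..m} \<union> {m<..d}" using assms by auto
  then show ?thesis
    unfolding cascade_sum_def by (simp add: sum.union_disjoint ivl_disj_int)
qed

lemma cascade_sum_diff:
  assumes "m \<le> d" "\<And>l. m < l \<Longrightarrow> l \<le> d \<Longrightarrow> \<beta> l = \<gamma> l"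
  obtains t where "cascade_sum r d \<beta> = cascade_sum r m \<beta> + t"
    and "cascade_sum r d \<gamma> = cascade_sum r m \<gamma> + t"
proof
  show "cascade_sum r d \<gamma> = cascade_sum r m \<gamma> + (\<Sum>l\<in>{m<..d}. \<beta> l choose (l + r))"
    using cascade_sum_split[OF assms(1)] assms(2) by simp
qed (rule cascade_sum_split[OF assms(1)])

section \<open>Pascal estimates\<close>

text \<open>
  In each step, the part up to \<open>m\<close> is below \<open>k m + 1 choose m \<le> k (m+1) choose m\<close>, and
  Pascal's rule absorbs the next term.  The induction can start at \<open>m = 0\<close>, where the bound is
  \<open>1\<close> whatever the meaningless value \<open>k 0\<close> is.
\<close>

lemma cascade_sum_less:
  "cascade m k \<Longrightarrow> cascade_sum 0 m k < Suc (k m) choose m"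
proof (induction m)
  case (Suc m)
  have "Suc (k m) choose m \<le> k (Suc m) choose m"
  proof (cases m)
    case (Suc n)
    then show ?thesis using cascade_Suc[OF Suc.prems] by (intro binomial_right_mono) simp
  qed simp
  then show ?case using Suc.IH[OF cascade_restrict[OF Suc.prems]] by simp
qed simp

text \<open>
  The same estimate started at an index \<open>j\<close> below which all terms vanish: Pascal's rule at \<open>j\<close> leaves
  the slack \<open>k j choose (j + r - 1)\<close>, which survives all later steps.
\<close>

lemma cascade_sum_gap:
  assumes "cascade m k" "1 \<le> j" "j \<le> m" "\<And>l. 1 \<le> l \<Longrightarrow> l < j \<Longrightarrow> k l < l"
  shows "cascade_sum r m k + (k j choose (j + r - 1)) \<le> Suc (k m) choose (m + r)"
  using assms(3,1)
proof (induction m rule: dec_induct)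
  case base
  obtain n where n: "j = Suc n" using assms(2) by (cases j) auto
  have "cascade_sum r n k = 0"
    using assms(4) n by (intro cascade_sum_eq_0) (simp add: trans_less_add1)
  then show ?case using n by simp
next
  case (step m)
  have "Suc (k m) choose (m + r) \<le> k (Suc m) choose (m + r)"
    using cascade_Suc[OF step.prems] step.hyps assms(2) by (intro binomial_right_mono) simp
  then show ?case using step.IH[OF cascade_restrict[OF step.prems]] by simp
qed

section \<open>Lexicographic comparison and uniqueness\<close>

lemma cascade_sum_lex:
  assumes "cascade d \<beta>" "cascade d \<gamma>" "1 \<le> m" "m \<le> d"
    and "\<And>l. m < l \<Longrightarrow> l \<le> d \<Longrightarrow> \<beta> l = \<gamma> l" and "\<beta> m < \<gamma> m"
  shows "cascade_sum 0 d \<beta> < cascade_sum 0 d \<gamma>"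
proof -
  have "cascade_sum 0 m \<beta> < Suc (\<beta> m) choose m"
    by (rule cascade_sum_less[OF cascade_restrict[OF assms(1,4)]])
  also have "\<dots> \<le> \<gamma> m choose m" using assms(6) by (intro binomial_right_mono) simp
  also have "\<dots> \<le> cascade_sum 0 m \<gamma>" using top_term_le_cascade_sum[OF assms(3), of \<gamma> 0] by simp
  finally have "cascade_sum 0 m \<beta> < cascade_sum 0 m \<gamma>" .
  moreover obtain t where "cascade_sum 0 d \<beta> = cascade_sum 0 m \<beta> + t"
      "cascade_sum 0 d \<gamma> = cascade_sum 0 m \<gamma> + t"
    by (rule cascade_sum_diff[OF assms(4,5)])
  ultimately show ?thesis by simp
qed

lemma highest_difference:
  fixes \<beta> \<gamma> :: "nat \<Rightarrow> nat"
  assumes "l \<in> {1..d}" "\<beta> l \<noteq> \<gamma> l"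
  obtains m where "1 \<le> m" "m \<le> d" "\<beta> m \<noteq> \<gamma> m" "\<And>l. m < l \<Longrightarrow> l \<le> d \<Longrightarrow> \<beta> l = \<gamma> l"
proof -
  let ?D = "{l \<in> {1..d}. \<beta> l \<noteq> \<gamma> l}"
  have "finite ?D" "?D \<noteq> {}" using assms by auto
  then have "Max ?D \<in> ?D" "\<And>l. l \<in> ?D \<Longrightarrow> l \<le> Max ?D" using Max_in[of ?D] Max_ge[of ?D] by blast+
  then obtain m where m: "m \<in> ?D" "\<And>l. l \<in> ?D \<Longrightarrow> l \<le> m" by (rule that)
  show ?thesis
  proof (rule that)
    show "\<beta> l = \<gamma> l" if "m < l" "l \<le> d" for l
      using m(2)[of l] that by force
  qed (use m(1) in auto)
qed

lemma cascade_unique: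
  assumes "cascade d \<beta>" "cascade d \<gamma>" "cascade_sum 0 d \<beta> = cascade_sum 0 d \<gamma>" "l \<in> {1..d}"
  shows "\<beta> l = \<gamma> l"
proof (rule ccontr)
  assume "\<beta> l \<noteq> \<gamma> l"
  then obtain m where m: "1 \<le> m" "m \<le> d" "\<beta> m \<noteq> \<gamma> m"
      "\<And>l. m < l \<Longrightarrow> l \<le> d \<Longrightarrow> \<beta> l = \<gamma> l"
    by (rule highest_difference[OF assms(4)]) blast
  from m(3) consider "\<beta> m < \<gamma> m" | "\<gamma> m < \<beta> m" by linarith
  then show False
  proof cases
    case 1
    show False using cascade_sum_lex[OF assms(1,2) m(1,2,4) 1] assms(3) by simp
  next
    case 2
    show False using cascade_sum_lex[OF assms(2,1) m(1,2) m(4)[symmetric] 2] assms(3) by simp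
  qed
qed

section \<open>Binomial expansions as padded sequences\<close>

lemma pad_sum:
  assumes "1 \<le> j"
  shows "cascade_sum r d (pad j k) = (\<Sum>l = j..d. k l choose (l + r))"
proof -
  have "cascade_sum r d (pad j k) = (\<Sum>l = j..d. pad j k l choose (l + r))"
    unfolding cascade_sum_def
    using assms by (intro sum.mono_neutral_right) (auto simp: pad_def)
  then show ?thesis by (simp add: pad_def)
qed

lemma cascade_pad:
  assumes "binomial_expansion d a j k"
  shows "cascade d (pad j k)"
  unfolding cascade_def
proof
  fix l assume l: "l \<in> {1..<d}"
  have k: "j \<le> k j" "\<And>l. j \<le> l \<Longrightarrow> l < d \<Longrightarrow> k l < k (Suc l)"
    using assms by (auto simp: binomial_expansion_def)
  consider "Suc l < j" | "Suc l = j" | "j \<le> l" by linarith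
  then show "pad j k l < pad j k (Suc l)"
  proof cases
    case 2
    then have "pad j k l = l - 1" "pad j k (Suc l) = k j" by (auto simp: pad_def)
    then show ?thesis using k(1) 2 by linarith
  qed (use k(2)[of l] l in \<open>auto simp: pad_def\<close>)
qed

lemma pad_value:
  assumes "binomial_expansion d a j k"
  shows "cascade_sum 0 d (pad j k) = a"
  using assms pad_sum[of j 0 d k] by (simp add: binomial_expansion_def)

lemma binomial_shift_eq:
  assumes "binomial_expansion d a j k"
  shows "binomial_shift d a = cascade_sum 1 d (pad j k)"
  unfolding binomial_shift_def
proof (rule the_equality)
  show "\<exists>j' k'. binomial_expansion d a j' k' \<and>
      cascade_sum 1 d (pad j k) = (\<Sum>l = j'..d. k' l choose (l + 1))"
    using assms pad_sum[of j 1 d k] by (auto simp: binomial_expansion_def)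
next
  fix s assume "\<exists>j' k'. binomial_expansion d a j' k' \<and> s = (\<Sum>l = j'..d. k' l choose (l + 1))"
  then obtain j' k' where e: "binomial_expansion d a j' k'"
      and s: "s = (\<Sum>l = j'..d. k' l choose (l + 1))" by blast
  then have "s = cascade_sum 1 d (pad j' k')"
    using pad_sum[of j' 1 d k'] by (simp add: binomial_expansion_def)
  moreover have "pad j' k' l = pad j k l" if "l \<in> {1..d}" for l
    using cascade_unique[OF cascade_pad[OF e] cascade_pad[OF assms] _ that]
      pad_value[OF e] pad_value[OF assms] by simp
  ultimately show "s = cascade_sum 1 d (pad j k)" by (simp add: cascade_sum_def)
qed

section \<open>Numbers with equal shifts\<close>

text \<open>
  The slack in \<open>cascade_sum_gap\<close>, made explicit: it is at least \<open>j choose (j - 1) = j\<close> for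
  the numbers and at least \<open>j choose j = 1\<close> for the shifts.
\<close>

lemma cascade_sum_gap_between:
  assumes "cascade m \<beta>" "1 \<le> j" "j \<le> m" "j \<le> \<beta> j"
    and "\<And>l. 1 \<le> l \<Longrightarrow> l < j \<Longrightarrow> \<beta> l < l" and "\<beta> m < \<gamma> m"
  shows "cascade_sum 0 m \<beta> + j \<le> cascade_sum 0 m \<gamma>"
    and "cascade_sum 1 m \<beta> < cascade_sum 1 m \<gamma>"
proof -
  have gap: "cascade_sum r m \<beta> + (\<beta> j choose (j + r - 1)) \<le> cascade_sum r m \<gamma>" for r
  proof -
    have "cascade_sum r m \<beta> + (\<beta> j choose (j + r - 1)) \<le> Suc (\<beta> m) choose (m + r)"
      using cascade_sum_gap[OF assms(1-3,5)] .
    also have "\<dots> \<le> \<gamma> m choose (m + r)" using assms(6) by (intro binomial_right_mono) simp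
    also have "\<dots> \<le> cascade_sum r m \<gamma>" using assms by (intro top_term_le_cascade_sum) simp
    finally show ?thesis .
  qed
  obtain n where n: "j = Suc n" using assms(2) by (cases j) auto
  have "j = j choose (j - 1)" using n by simp
  also have "\<dots> \<le> \<beta> j choose (j - 1)" using assms(4) by (rule binomial_right_mono)
  finally show "cascade_sum 0 m \<beta> + j \<le> cascade_sum 0 m \<gamma>" using gap[of 0] by simp
  have "0 < \<beta> j choose (j + 1 - 1)" using assms(4) by simp
  then show "cascade_sum 1 m \<beta> < cascade_sum 1 m \<gamma>" using gap[of 1] by linarith
qed

text \<open>
  If \<open>\<gamma> m = m\<close>, then \<open>\<gamma>\<close> is on or below the diagonal everywhere, so each term is at most
  \<open>l choose l = 1\<close> in the number and vanishes in the shift.  If \<open>\<gamma> m > m\<close>, then the top term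
  alone is at least \<open>m + 1 choose m\<close> in the number and positive in the shift.
\<close>

lemma cascade_shift_eq_0_iff:
  assumes "cascade m \<gamma>" "1 \<le> m" "m \<le> \<gamma> m"
  shows "cascade_sum 1 m \<gamma> = 0 \<longleftrightarrow> cascade_sum 0 m \<gamma> \<le> m"
proof (cases "\<gamma> m = m")
  case True
  have "\<gamma> l choose l \<le> 1" if "l \<in> {1..m}" for l
  proof -
    have "\<gamma> l \<le> l" using cascade_slope[OF assms(1), of l] that True by auto
    then show ?thesis using binomial_right_mono[of "\<gamma> l" l l] by simp
  qed
  then have "cascade_sum 0 m \<gamma> \<le> m"
    using sum_bounded_above[of "{1..m}" "\<lambda>l. \<gamma> l choose l" 1] by (simp add: cascade_sum_def)
  then show ?thesis using cascade_sum_below_diagonal[OF assms(1), of 1] True by simp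
next
  case False
  then have "Suc m \<le> \<gamma> m" using assms(3) by simp
  then have "Suc m choose m \<le> \<gamma> m choose (m + 0)" "0 < \<gamma> m choose (m + 1)"
    using binomial_right_mono[of "Suc m" "\<gamma> m" m] by simp_all
  then have "Suc m choose m \<le> cascade_sum 0 m \<gamma>" "0 < cascade_sum 1 m \<gamma>"
    using top_term_le_cascade_sum[OF assms(2)] by (blast intro: order_trans less_le_trans)+
  then show ?thesis by simp
qed

theorem lemma1p2p53:
  fixes d b c j i :: nat and bs cs :: "nat \<Rightarrow> nat"
  assumes "d \<ge> 1"
    and "c > b" and "b > 0"
    and "binomial_expansion d b j bs"
    and "binomial_expansion d c i cs"
  shows "binomial_shift d b = binomial_shift d c \<longleftrightarrow> j \<ge> 2 \<and> c - b \<le> j - 1"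
proof -
  define \<beta> \<gamma> where "\<beta> = pad j bs" and "\<gamma> = pad i cs"
  have casc: "cascade d \<beta>" "cascade d \<gamma>"
    and val: "cascade_sum 0 d \<beta> = b" "cascade_sum 0 d \<gamma> = c"
    and shift: "binomial_shift d b = cascade_sum 1 d \<beta>" "binomial_shift d c = cascade_sum 1 d \<gamma>"
    using assms(4,5) cascade_pad pad_value binomial_shift_eq by (auto simp: \<beta>_def \<gamma>_def)
  have j: "1 \<le> j" "j \<le> d" "j \<le> \<beta> j"
    using assms(4) by (auto simp: binomial_expansion_def \<beta>_def pad_def)
  have low: "\<beta> l = l - 1" if "l < j" for l
    using that by (simp add: \<beta>_def pad_def)
  have "\<not> (\<forall>l\<in>{1..d}. \<beta> l = \<gamma> l)"
  proof
    assume "\<forall>l\<in>{1..d}. \<beta> l = \<gamma> l"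
    then have "cascade_sum 0 d \<beta> = cascade_sum 0 d \<gamma>" by (simp add: cascade_sum_def)
    then show False using val assms(2) by simp
  qed
  then obtain l where "l \<in> {1..d}" "\<beta> l \<noteq> \<gamma> l" by blast
  then obtain m where m: "1 \<le> m" "m \<le> d" "\<beta> m \<noteq> \<gamma> m"
      and above: "\<And>l. m < l \<Longrightarrow> l \<le> d \<Longrightarrow> \<beta> l = \<gamma> l"
    by (rule highest_difference) blast
  have less: "\<beta> m < \<gamma> m"
  proof (rule ccontr)
    assume "\<not> \<beta> m < \<gamma> m"
    then have "\<gamma> m < \<beta> m" using m(3) by simp
    then have "cascade_sum 0 d \<gamma> < cascade_sum 0 d \<beta>"
      using above by (intro cascade_sum_lex[OF casc(2,1) m(1,2)]) auto
    then show False using val assms(2) by simp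
  qed
  obtain t0 where t0: "b = cascade_sum 0 m \<beta> + t0" "c = cascade_sum 0 m \<gamma> + t0"
    by (rule cascade_sum_diff[where r = 0 and \<beta> = \<beta> and \<gamma> = \<gamma>, OF m(2) above, unfolded val])
  obtain t1 where t1: "binomial_shift d b = cascade_sum 1 m \<beta> + t1"
      "binomial_shift d c = cascade_sum 1 m \<gamma> + t1"
    by (rule cascade_sum_diff[where r = 1 and \<beta> = \<beta> and \<gamma> = \<gamma>, OF m(2) above, folded shift])
  have casc_m: "cascade m \<beta>" "cascade m \<gamma>" using casc m(2) cascade_restrict by blast+
  show ?thesis
  proof (cases "j \<le> m")
    case True
    have "\<beta> l < l" if "1 \<le> l" "l < j" for l using low that by simp
    then have "cascade_sum 0 m \<beta> + j \<le> cascade_sum 0 m \<gamma>" "cascade_sum 1 m \<beta> < cascade_sum 1 m \<gamma>"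
      using cascade_sum_gap_between[where \<gamma> = \<gamma>, OF casc_m(1) j(1) True j(3) _ less] by blast+
    then have "\<not> c - b \<le> j - 1" "binomial_shift d b < binomial_shift d c"
      using t0 t1 j(1) by linarith+
    then show ?thesis by simp
  next
    case False
    then have \<beta>m: "\<beta> m = m - 1" using low by simp
    then have zero: "cascade_sum r m \<beta> = 0" for r
      using m(1) by (intro cascade_sum_below_diagonal[OF casc_m(1)]) simp
    have \<gamma>m: "m \<le> \<gamma> m" using less \<beta>m by simp
    have jm: "j = Suc m"
    proof (rule ccontr)
      assume "j \<noteq> Suc m"
      then have "Suc m < j" using False by simp
      then have "\<gamma> (Suc m) = m" using above[of "Suc m"] low[of "Suc m"] j(2) by simp
      moreover have "\<gamma> m < \<gamma> (Suc m)"
        using \<open>Suc m < j\<close> j(2) m(1) casc(2) by (simp add: cascade_def)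
      ultimately show False using \<gamma>m by simp
    qed
    have "c - b = cascade_sum 0 m \<gamma>" using t0 zero[of 0] by linarith
    moreover have "binomial_shift d b = binomial_shift d c \<longleftrightarrow> cascade_sum 1 m \<gamma> = 0"
      using t1 zero[of 1] by linarith
    ultimately show ?thesis
      using cascade_shift_eq_0_iff[OF casc_m(2) m(1) \<gamma>m] jm m(1) by simp
  qed
qed

end
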